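(* Let $(\mathcal V,d,\mu)$ be the weighted homogeneous tree described in the context. Let $T$ be a linear operator which is bounded on $L^2(\mu)$ and admits a locally integrable kernel $K$ off the diagonal that satisfies $$\sup_{\tilde R\in\mathcal R}\ \sup_{y,z\in\tilde R}\int_{(\tilde R^* )^c}|K(y,x)-K(z,x)|\,\mathrm d\mu(x)<\infty,$$ where the first supremum is taken over all Calderón–Zygmund sets $\tilde R$ and $(\tilde R^* )^c=\mathcal V\setminus\tilde R^*$. Then $T$ extends to a bounded operator from $L^\infty(\mu)$ to $BMO(\mu)$.
   Context: Tree. Let $m\ge 2$ be an integer and let $T_{m}=(\mathcal V,\mathcal E)$ be the infinite homogeneous tree of order $m+1$: a connected acyclic graph in which every vertex has exactly $m+1$ neighbours. Let $d(x,y)$ be the length of the shortest path between $x$ and $y$. Fix a doubly-infinite geodesic $g_0\subset\mathcal V$ (a connected subset such that each of its vertices has exactly two neighbours in it and the shortest path between any two of its vertices lies in it) and a map $N:g_0\to\mathbb Z$ with $|N(x)-N(y)|=d(x,y)$ for all $x,y\in g_0$. The level function is $\ell(x)=N(x')-d(x,x')$, where $x'$ is the vertex of $g_0$ closest to $x$. We say that $x$ lies below $y$ (and $y$ lies above $x$) if $\ell(x)=\ell(y)-d(x,y)$. The measure $\mu$ is defined by $\int_{\mathcal V} f\,\mathrm d\mu=\sum_{x\in\mathcal V}f(x)m^{\ell(x)}$. Functions are complex-valued. Calderón–Zygmund sets. A (nonempty) set $\tilde R\subset \mathcal V$ is a Calderón–Zygmund set if either it is a single vertex (degenerate case; then $h(\tilde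 R)=1$) or there are $x_R\in\mathcal V$ and an integer $h\ge 1$ such that $\tilde R=\{x: x\text{ lies below }x_R,\ h/2\le \ell(x_R)-\ell(x)<4h\}$ (then $h(\tilde R)=h$). Let $\mathcal R$ be the family of all Calderón–Zygmund sets. For $\tilde R\in\mathcal R$ define $\tilde R^*=\{x\in\mathcal V: d(x,\tilde R)<h(\tilde R)/4\}$. BMO. $BMO(\mu)$ is the quotient by constant functions of the space of functions $f:\mathcal V\to\mathbb C$ with $\|f\|_{BMO}=\sup_{\tilde R\in\mathcal R}\frac1{\mu(\tilde R)}\int_{\tilde R}|f-f_{\tilde R}|\,\mathrm d\mu<\infty$, where $f_{\tilde R}=\mu(\tilde R)^{-1}\int_{\tilde R}f\,\mathrm d\mu$. Kernel. That $T$ admits the kernel $K$ off the diagonal means, as usual, that $Tf(x)=\int_{\mathcal V}K(x,y)f(y)\,\mathrm d\mu(y)$ for every finitely supported $f$ and every $x$ outside the support of $f$. *)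

theory Defs
  imports "HOL-Analysis.Analysis" "HOL-Probability.Essential_Supremum"
begin

text \<open>
  The vertices of the tree are the elements of a type \<open>'v\<close>, and a graph on \<open>'v\<close> is given by its
  adjacency relation. (The predicate \<open>tree\<close> of the Graph Theory library does not apply: in a
  symmetric digraph an edge traversed back and forth is already a cycle.)
  A walk is the list of the vertices it visits, so its length as a path is one less than
  the length of the list.
\<close>

definition walk :: "('v \<Rightarrow> 'v \<Rightarrow> bool) \<Rightarrow> 'v \<Rightarrow> 'v list \<Rightarrow> 'v \<Rightarrow> bool" where
  "walk adj x p y \<longleftrightarrow> p \<noteq> [] \<and> hd p = x \<and> last p = y \<and> successively adj p"

definition connected_in :: "('v \<Rightarrow> 'v \<Rightarrow> bool) \<Rightarrow> 'v set \<Rightarrow> bool" where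
  "connected_in adj A \<longleftrightarrow> (\<forall>x\<in>A. \<forall>y\<in>A. \<exists>p. walk adj x p y \<and> set p \<subseteq> A)"

definition acyclic_graph :: "('v \<Rightarrow> 'v \<Rightarrow> bool) \<Rightarrow> bool" where
  "acyclic_graph adj \<longleftrightarrow>
     \<not> (\<exists>p. 3 \<le> length p \<and> distinct p \<and> successively adj p \<and> adj (last p) (hd p))"

definition homogeneous_tree :: "nat \<Rightarrow> ('v \<Rightarrow> 'v \<Rightarrow> bool) \<Rightarrow> bool" where
  "homogeneous_tree m adj \<longleftrightarrow>
     symp adj \<and> irreflp adj \<and> connected_in adj UNIV \<and> acyclic_graph adj \<and>
     (\<forall>x. card {y. adj x y} = m + 1)"

definition gdist :: "('v \<Rightarrow> 'v \<Rightarrow> bool) \<Rightarrow> 'v \<Rightarrow> 'v \<Rightarrow> nat" where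
  "gdist adj x y = (LEAST n. \<exists>p. walk adj x p y \<and> length p = Suc n)"

definition infinite_geodesic :: "('v \<Rightarrow> 'v \<Rightarrow> bool) \<Rightarrow> 'v set \<Rightarrow> bool" where
  "infinite_geodesic adj G \<longleftrightarrow>
     G \<noteq> {} \<and> connected_in adj G \<and>
     (\<forall>x\<in>G. card {y\<in>G. adj x y} = 2) \<and>
     (\<forall>x\<in>G. \<forall>y\<in>G. \<forall>p. walk adj x p y \<and> length p = Suc (gdist adj x y) \<longrightarrow> set p \<subseteq> G)"

definition level :: "('v \<Rightarrow> 'v \<Rightarrow> bool) \<Rightarrow> 'v set \<Rightarrow> ('v \<Rightarrow> int) \<Rightarrow> 'v \<Rightarrow> int" where
  "level adj G N x = (let x' = arg_min_on (gdist adj x) G in N x' - int (gdist adj x x'))"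

definition lies_below :: "('v \<Rightarrow> 'v \<Rightarrow> bool) \<Rightarrow> ('v \<Rightarrow> int) \<Rightarrow> 'v \<Rightarrow> 'v \<Rightarrow> bool" where
  "lies_below adj lev x y \<longleftrightarrow> lev x = lev y - int (gdist adj x y)"

definition level_measure :: "nat \<Rightarrow> ('v \<Rightarrow> int) \<Rightarrow> 'v measure" where
  "level_measure m lev = density (count_space UNIV) (\<lambda>x. ennreal (real m powi lev x))"

text \<open>
  \<open>cz_set adj lev R h\<close>: \<open>R\<close> is a Calderon-Zygmund set with \<open>h(R) = h\<close>. On a homogeneous tree with
  \<open>m \<ge> 2\<close> the set \<open>R\<close> determines \<open>h\<close>, so a supremum over pairs \<open>(R, h)\<close> is a supremum over \<open>R\<close>.
\<close>

definition cz_set :: "('v \<Rightarrow> 'v \<Rightarrow> bool) \<Rightarrow> ('v \<Rightarrow> int) \<Rightarrow> 'v set \<Rightarrow> nat \<Rightarrow> bool" where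
  "cz_set adj lev R h \<longleftrightarrow>
     (\<exists>x. R = {x}) \<and> h = 1 \<or>
     1 \<le> h \<and>
     (\<exists>x\<^sub>R. R = {x. lies_below adj lev x x\<^sub>R \<and>
                  real h / 2 \<le> real_of_int (lev x\<^sub>R - lev x) \<and>
                  lev x\<^sub>R - lev x < 4 * int h})"

definition cz_dilation :: "('v \<Rightarrow> 'v \<Rightarrow> bool) \<Rightarrow> 'v set \<Rightarrow> nat \<Rightarrow> 'v set" where
  "cz_dilation adj R h = {x. real (INF y\<in>R. gdist adj x y) < real h / 4}"

definition mean_on :: "'v measure \<Rightarrow> 'v set \<Rightarrow> ('v \<Rightarrow> complex) \<Rightarrow> complex" where
  "mean_on M R f = (LINT x:R|M. f x) /\<^sub>R measure M R"

definition bmo_norm ::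
  "('v \<Rightarrow> 'v \<Rightarrow> bool) \<Rightarrow> ('v \<Rightarrow> int) \<Rightarrow> 'v measure \<Rightarrow> ('v \<Rightarrow> complex) \<Rightarrow> ennreal" where
  "bmo_norm adj lev M f =
     (SUP R\<in>{R. \<exists>h. cz_set adj lev R h}.
        (\<integral>\<^sup>+x\<in>R. ennreal (norm (f x - mean_on M R f)) \<partial>M) / emeasure M R)"

text \<open>Equality of the classes in the quotient by the constant functions.\<close>

definition eq_mod_const :: "('v \<Rightarrow> complex) \<Rightarrow> ('v \<Rightarrow> complex) \<Rightarrow> bool" where
  "eq_mod_const f g \<longleftrightarrow> (\<exists>c. \<forall>x. f x = g x + c)"

text \<open>
  Elements of \<open>L\<^sup>2\<close> and \<open>L\<^sup>\<infinity>\<close> are represented by functions. Every vertex has positive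
  \<open>level_measure\<close> when \<open>m \<ge> 1\<close>, so that functions which agree almost everywhere are equal.
\<close>

definition L2_space :: "'v measure \<Rightarrow> ('v \<Rightarrow> complex) set" where
  "L2_space M = {f \<in> borel_measurable M. integrable M (\<lambda>x. (norm (f x))\<^sup>2)}"

definition L2_fnorm :: "'v measure \<Rightarrow> ('v \<Rightarrow> complex) \<Rightarrow> real" where
  "L2_fnorm M f = sqrt (LINT x|M. (norm (f x))\<^sup>2)"

definition Linf_norm :: "'v measure \<Rightarrow> ('v \<Rightarrow> complex) \<Rightarrow> ennreal" where
  "Linf_norm M f = esssup M (\<lambda>x. ennreal (norm (f x)))"

definition Linf_space :: "'v measure \<Rightarrow> ('v \<Rightarrow> complex) set" where
  "Linf_space M = {f \<in> borel_measurable M. Linf_norm M f < \<infinity>}"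

definition bounded_linear_on_L2 ::
  "'v measure \<Rightarrow> (('v \<Rightarrow> complex) \<Rightarrow> 'v \<Rightarrow> complex) \<Rightarrow> bool" where
  "bounded_linear_on_L2 M T \<longleftrightarrow>
     (\<forall>f\<in>L2_space M. \<forall>g\<in>L2_space M. T (\<lambda>x. f x + g x) = (\<lambda>x. T f x + T g x)) \<and>
     (\<forall>a. \<forall>f\<in>L2_space M. T (\<lambda>x. a * f x) = (\<lambda>x. a * T f x)) \<and>
     (\<exists>C. \<forall>f\<in>L2_space M. T f \<in> L2_space M \<and> L2_fnorm M (T f) \<le> C * L2_fnorm M f)"

definition bounded_linear_Linf_BMO ::
  "('v \<Rightarrow> 'v \<Rightarrow> bool) \<Rightarrow> ('v \<Rightarrow> int) \<Rightarrow> 'v measure \<Rightarrow> (('v \<Rightarrow> complex) \<Rightarrow> 'v \<Rightarrow> complex) \<Rightarrow> bool" where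
  "bounded_linear_Linf_BMO adj lev M S \<longleftrightarrow>
     (\<forall>f\<in>Linf_space M. \<forall>g\<in>Linf_space M.
        eq_mod_const (S (\<lambda>x. f x + g x)) (\<lambda>x. S f x + S g x)) \<and>
     (\<forall>a. \<forall>f\<in>Linf_space M. eq_mod_const (S (\<lambda>x. a * f x)) (\<lambda>x. a * S f x)) \<and>
     (\<exists>C::real. \<forall>f\<in>Linf_space M.
        bmo_norm adj lev M (S f) < \<infinity> \<and> bmo_norm adj lev M (S f) \<le> ennreal C * Linf_norm M f)"

text \<open>
  The compact subsets of the discrete space \<open>\<V> \<times> \<V>\<close> minus the diagonal are the finite ones.
\<close>

definition locally_integrable_off_diagonal ::
  "'v measure \<Rightarrow> ('v \<Rightarrow> 'v \<Rightarrow> complex) \<Rightarrow> bool" where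
  "locally_integrable_off_diagonal M K \<longleftrightarrow>
     (\<forall>A. finite A \<and> A \<inter> Id = {} \<longrightarrow> set_integrable (M \<Otimes>\<^sub>M M) A (\<lambda>(x, y). K x y))"

definition admits_kernel ::
  "'v measure \<Rightarrow> (('v \<Rightarrow> complex) \<Rightarrow> 'v \<Rightarrow> complex) \<Rightarrow> ('v \<Rightarrow> 'v \<Rightarrow> complex) \<Rightarrow> bool" where
  "admits_kernel M T K \<longleftrightarrow>
     (\<forall>f x. finite {y. f y \<noteq> 0} \<and> f x = 0 \<longrightarrow> T f x = (LINT y|M. K x y * f y))"

end

theory Submission
  imports Defs
begin

text \<open>
  The extension is the classical one: truncate \<open>f\<close> to a finite set, apply \<open>T\<close> to the truncation,
  and integrate the rest of \<open>f\<close> against a difference of two kernel rows, which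
  converges where the kernel itself need not. For a finite set \<open>A\<close> put
  \<open>increment A f x z = T(f 1\<^sub>A)(x) - T(f 1\<^sub>A)(z) + \<integral>\<^bsub>-A\<^esub> (K(x,y) - K(z,y)) f(y) d\<mu>(y)\<close>.
  As \<open>K\<close> represents \<open>T\<close> off the support, this does not depend on the finite set \<open>A\<close> containing
  \<open>x\<close> and \<open>z\<close> (\<open>increment_mono\<close>), and it is additive along \<open>x, z, b\<close>; so fixing a base point \<open>b\<close>,
  \<open>S f(x) = increment {x,b} f x b\<close> is a function whose differences are the increments. On a
  Calderon-Zygmund set \<open>R\<close>, taking \<open>A = R\<^sup>*\<close> shows that \<open>S f\<close> equals, up to a constant, \<open>T(f 1\<^bsub>R*\<^esub>)\<close>
  plus a term bounded by the Hoermander constant times \<open>\<parallel>f\<parallel>\<^sub>\<infinity>\<close>. The mean over \<open>R\<close> of the former is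
  controlled by the \<open>L\<^sup>2\<close> bound, because \<open>\<mu>(R\<^sup>*) \<le> 2 \<mu>(R)\<close> (\<open>extension_oscillation\<close>). If \<open>f\<close> is
  also in \<open>L\<^sup>2\<close>, exhausting the tree by finite sets gives \<open>S f = T f - T f(b)\<close>
  (\<open>extension_extends\<close>).

  Three properties of the tree enter: \<open>R\<^sup>*\<close> is finite, \<open>\<mu>(R\<^sup>*) \<le> 2 \<mu>(R)\<close>, and any two vertices lie in a
  common set \<open>R\<close>, which makes the integral in the increment converge. All three follow from the
  fact that every vertex has exactly one neighbour one level higher, its parent, while its other
  \<open>m\<close> neighbours are one level lower (\<open>unique_upper_neighbour\<close>, \<open>level_adj\<close>). Indeed \<open>x\<close> then lies
  below \<open>r\<close> iff \<open>r\<close> is an iterated parent of \<open>x\<close>, so that the descendants of \<open>r\<close> in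
  generation \<open>k\<close> number \<open>m\<^sup>k\<close> and have total mass \<open>m\<^bsup>\<ell>(r)\<^esup>\<close> for every \<open>k\<close>; hence \<open>\<mu>(R)\<close> just counts
  generations.
\<close>

section \<open>Operators with a Hoermander kernel on a weighted discrete space\<close>

definition cut :: "'v set \<Rightarrow> ('v \<Rightarrow> complex) \<Rightarrow> 'v \<Rightarrow> complex" where
  "cut A f x = (if x \<in> A then f x else 0)"

lemma cut_add: "cut A (\<lambda>x. f x + g x) = (\<lambda>x. cut A f x + cut A g x)"
  by (auto simp: cut_def)

lemma cut_scale: "cut A (\<lambda>x. c * f x) = (\<lambda>x. c * cut A f x)"
  by (auto simp: cut_def)

lemma cut_union_disjoint: "A \<inter> B = {} \<Longrightarrow> cut (A \<union> B) f = (\<lambda>x. cut A f x + cut B f x)"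
  by (rule ext) (auto simp: cut_def)

lemma cut_UNIV: "cut UNIV f = f"
  by (rule ext) (simp add: cut_def)

lemma finite_support_cut: "finite A \<Longrightarrow> finite {x. cut A f x \<noteq> 0}"
  by (rule finite_subset[of _ A]) (auto simp: cut_def)

locale weighted_points =
  fixes w :: "'v \<Rightarrow> real"
  assumes w_pos: "w x > 0"
begin

definition M :: "'v measure" where "M = density (count_space UNIV) (\<lambda>x. ennreal (w x))"

lemma space_M [simp]: "space M = UNIV" and sets_M [simp]: "sets M = UNIV"
  by (simp_all add: M_def)

lemma measurable_M [measurable, simp]: "f \<in> measurable M borel"
  by (simp add: M_def)

lemma AE_M_iff: "(AE x in M. P x) \<longleftrightarrow> (\<forall>x. P x)"
  using w_pos unfolding M_def by (subst AE_density) (simp_all add: AE_count_space)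

lemma integrable_finite_support:
  fixes g :: "'v \<Rightarrow> 'b::{banach, second_countable_topology}"
  assumes "finite {x. g x \<noteq> 0}"
  shows "integrable M g"
proof -
  have "integrable (count_space UNIV) (\<lambda>x. w x *\<^sub>R g x)"
  proof (rule integrableI_bounded)
    have "(\<integral>\<^sup>+ x. ennreal (norm (w x *\<^sub>R g x)) \<partial>count_space UNIV) =
        (\<Sum>x | g x \<noteq> 0. ennreal (norm (w x *\<^sub>R g x)))"
      by (rule nn_integral_count_space') (use assms in auto)
    then show "(\<integral>\<^sup>+ x. ennreal (norm (w x *\<^sub>R g x)) \<partial>count_space UNIV) < \<infinity>"
      by (simp add: less_top[symmetric])
  qed simp
  then show ?thesis
    unfolding M_def using w_pos by (subst integrable_density) (auto simp: less_imp_le)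
qed

lemma integral_finite_support:
  fixes g :: "'v \<Rightarrow> 'b::{banach, second_countable_topology}"
  assumes "finite A" "\<And>x. x \<notin> A \<Longrightarrow> g x = 0"
  shows "(LINT x|M. g x) = (\<Sum>x\<in>A. w x *\<^sub>R g x)"
proof -
  have "(LINT x|M. g x) = (LINT x|count_space UNIV. w x *\<^sub>R g x)"
    unfolding M_def using w_pos by (intro integral_density) (auto simp: less_imp_le)
  also have "\<dots> = (\<Sum>x | x \<in> UNIV \<and> w x *\<^sub>R g x \<noteq> 0. w x *\<^sub>R g x)"
    by (rule lebesgue_integral_count_space_finite_support)
       (use assms in \<open>auto intro: finite_subset[of _ A]\<close>)
  also have "\<dots> = (\<Sum>x\<in>A. w x *\<^sub>R g x)"
    by (rule sum.mono_neutral_left) (use assms in auto)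
  finally show ?thesis .
qed

lemma set_integral_finite:
  fixes g :: "'v \<Rightarrow> 'b::{banach, second_countable_topology}"
  assumes "finite A"
  shows "(LINT x:A|M. g x) = (\<Sum>x\<in>A. w x *\<^sub>R g x)"
  using integral_finite_support[OF assms, of "\<lambda>x. indicator A x *\<^sub>R g x"]
  by (simp add: set_lebesgue_integral_def)

lemma nn_set_integral_finite:
  assumes "finite A" "\<And>x. g x \<ge> 0"
  shows "(\<integral>\<^sup>+x\<in>A. ennreal (g x) \<partial>M) = ennreal (\<Sum>x\<in>A. w x * g x)"
proof -
  have "(\<integral>\<^sup>+x\<in>A. ennreal (g x) \<partial>M) = (\<integral>\<^sup>+x. ennreal (indicator A x * g x) \<partial>M)"
    by (intro nn_integral_cong) (auto simp: indicator_def)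
  also have "\<dots> = ennreal (LINT x|M. indicator A x * g x)"
    by (intro nn_integral_eq_integral integrable_finite_support)
       (use assms in \<open>auto intro: finite_subset[of _ A] simp: indicator_def\<close>)
  also have "(LINT x|M. indicator A x * g x) = (\<Sum>x\<in>A. w x * g x)"
    using integral_finite_support[OF assms(1), of "\<lambda>x. indicator A x * g x"] by simp
  finally show ?thesis .
qed

lemma emeasure_finite: "finite A \<Longrightarrow> emeasure M A = ennreal (sum w A)"
  using nn_set_integral_finite[of A "\<lambda>_. 1"] by simp

lemma measure_finite: "finite A \<Longrightarrow> measure M A = sum w A"
  using emeasure_finite[of A] w_pos
  by (simp add: measure_def sum_nonneg less_imp_le)

lemma L2_space_iff: "f \<in> L2_space M \<longleftrightarrow> integrable M (\<lambda>x. (norm (f x))\<^sup>2)"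
  by (simp add: L2_space_def)

lemma L2_cut: "f \<in> L2_space M \<Longrightarrow> cut A f \<in> L2_space M"
  unfolding L2_space_iff
  by (rule Bochner_Integration.integrable_bound) (auto simp: cut_def)

lemma L2_cut_finite: "finite A \<Longrightarrow> cut A f \<in> L2_space M"
  unfolding L2_space_iff using finite_support_cut[of A f]
  by (intro integrable_finite_support) simp

lemma point_le_L2:
  assumes "f \<in> L2_space M"
  shows "w x * (norm (f x))\<^sup>2 \<le> (LINT y|M. (norm (f y))\<^sup>2)"
proof -
  have "w x * (norm (f x))\<^sup>2 = (LINT y|M. (norm (cut {x} f y))\<^sup>2)"
    by (subst integral_finite_support[of "{x}"]) (auto simp: cut_def)
  also have "\<dots> \<le> (LINT y|M. (norm (f y))\<^sup>2)"
    using assms L2_cut[OF assms, of "{x}"] unfolding L2_space_iff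
    by (intro integral_mono) (auto simp: cut_def)
  finally show ?thesis .
qed

lemma sum_le_L2:
  assumes "f \<in> L2_space M" "finite A"
  shows "(\<Sum>x\<in>A. w x * (norm (f x))\<^sup>2) \<le> (LINT y|M. (norm (f y))\<^sup>2)"
proof -
  have "(\<Sum>x\<in>A. w x * (norm (f x))\<^sup>2) = (LINT y|M. (norm (cut A f y))\<^sup>2)"
    using assms(2) by (subst integral_finite_support[of A]) (auto simp: cut_def)
  also have "\<dots> \<le> (LINT y|M. (norm (f y))\<^sup>2)"
    using assms L2_cut[OF assms(1), of A] unfolding L2_space_iff
    by (intro integral_mono) (auto simp: cut_def)
  finally show ?thesis .
qed

text \<open>
  The factor 2 pays for replacing the mean by an arbitrary constant \<open>c\<close>: the
  distance between the two is itself at most the average of \<open>\<bar>g - c\<bar>\<close>.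
\<close>

lemma mean_oscillation_le:
  assumes "finite A" "A \<noteq> {}"
  shows "(\<Sum>x\<in>A. w x * norm (g x - mean_on M A g)) \<le> 2 * (\<Sum>x\<in>A. w x * norm (g x - c))"
proof -
  let ?m = "mean_on M A g"
  have pos: "sum w A > 0" using assms w_pos by (intro sum_pos) auto
  have "sum w A *\<^sub>R (c - ?m) = (\<Sum>x\<in>A. w x *\<^sub>R (c - g x))"
    using pos assms(1)
    by (simp add: mean_on_def set_integral_finite measure_finite scaleR_diff_right sum_subtractf
        scaleR_sum_left)
  then have "sum w A * norm (c - ?m) = norm (\<Sum>x\<in>A. w x *\<^sub>R (c - g x))"
    using pos by (metis abs_of_pos norm_scaleR)
  also have "\<dots> \<le> (\<Sum>x\<in>A. w x * norm (g x - c))"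
    using w_pos by (intro sum_norm_le) (simp add: less_imp_le norm_minus_commute)
  finally have m: "sum w A * norm (c - ?m) \<le> (\<Sum>x\<in>A. w x * norm (g x - c))" .
  have "(\<Sum>x\<in>A. w x * norm (g x - ?m)) \<le> (\<Sum>x\<in>A. w x * (norm (g x - c) + norm (c - ?m)))"
  proof (intro sum_mono mult_left_mono)
    show "norm (g x - ?m) \<le> norm (g x - c) + norm (c - ?m)" for x
      using norm_triangle_ineq[of "g x - c" "c - ?m"] by simp
  qed (use w_pos in \<open>auto simp: less_imp_le\<close>)
  also have "\<dots> = (\<Sum>x\<in>A. w x * norm (g x - c)) + sum w A * norm (c - ?m)"
    by (simp add: distrib_left sum.distrib sum_distrib_right)
  finally show ?thesis using m by simp
qed

lemma Linf_norm_ge: "ennreal (norm (f x)) \<le> Linf_norm M f"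
  using esssup_AE[where M = M and f = "\<lambda>x. ennreal (norm (f x))"]
  by (simp add: AE_M_iff Linf_norm_def)

end

text \<open>
  A pair \<open>(R, R')\<close> in \<open>F\<close> is a Calderon-Zygmund set with its dilation,
  and \<open>B\<close> is an exhaustion by finite sets. The constant \<open>C\<^sub>T\<close>
  bounds the square of the operator norm of \<open>T\<close>, \<open>C\<^sub>K\<close> is the
  Hoermander constant, and \<open>C\<^sub>R\<close> bounds the growth of the measure under
  dilation.
\<close>

locale hormander_operator = weighted_points w
  for w :: "'v \<Rightarrow> real" +
  fixes T :: "('v \<Rightarrow> complex) \<Rightarrow> 'v \<Rightarrow> complex" and K :: "'v \<Rightarrow> 'v \<Rightarrow> complex"
    and F :: "('v set \<times> 'v set) set" and B :: "nat \<Rightarrow> 'v set"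
    and C\<^sub>T C\<^sub>K C\<^sub>R :: real
  assumes T_add: "f \<in> L2_space M \<Longrightarrow> g \<in> L2_space M \<Longrightarrow>
      T (\<lambda>x. f x + g x) = (\<lambda>x. T f x + T g x)"
    and T_scale: "f \<in> L2_space M \<Longrightarrow> T (\<lambda>x. c * f x) = (\<lambda>x. c * T f x)"
    and T_L2: "f \<in> L2_space M \<Longrightarrow> T f \<in> L2_space M"
    and T_bound: "f \<in> L2_space M \<Longrightarrow>
      (LINT x|M. (norm (T f x))\<^sup>2) \<le> C\<^sub>T * (LINT x|M. (norm (f x))\<^sup>2)"
    and kernel: "admits_kernel M T K"
    and F_finite: "(R, R') \<in> F \<Longrightarrow> finite R'" and F_subset: "(R, R') \<in> F \<Longrightarrow> R \<subseteq> R'"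
    and F_measure: "(R, R') \<in> F \<Longrightarrow> measure M R' \<le> C\<^sub>R * measure M R"
    and F_pair: "\<exists>R R'. (R, R') \<in> F \<and> x \<in> R \<and> y \<in> R"
    and hormander: "(R, R') \<in> F \<Longrightarrow> y \<in> R \<Longrightarrow> z \<in> R \<Longrightarrow>
      (\<integral>\<^sup>+x\<in>- R'. ennreal (norm (K y x - K z x)) \<partial>M) \<le> ennreal C\<^sub>K"
    and consts_nonneg: "C\<^sub>T \<ge> 0" "C\<^sub>K \<ge> 0"
    and B_finite: "finite (B n)" and B_exhausts: "\<forall>\<^sub>F n in sequentially. x \<in> B n"
begin

lemma T_cut_union:
  assumes "finite A" "finite A'" "A \<inter> A' = {}"
  shows "T (cut (A \<union> A') f) x = T (cut A f) x + T (cut A' f) x"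
  using assms by (simp add: cut_union_disjoint T_add L2_cut_finite)

lemma T_off_support:
  assumes "finite A" "x \<notin> A"
  shows "T (cut A f) x = (LINT y|M. K x y * cut A f y)"
  using kernel finite_support_cut[OF assms(1), of f] assms(2)
  unfolding admits_kernel_def by (simp add: cut_def)

lemma kernel_difference_integrable_off_dilation:
  assumes "(R, R') \<in> F" "x \<in> R" "z \<in> R" "\<And>y. norm (f y) \<le> a"
  shows "integrable M (cut (- R') (\<lambda>y. (K x y - K z y) * f y))"
    and "norm (LINT y|M. cut (- R') (\<lambda>y. (K x y - K z y) * f y) y) \<le> C\<^sub>K * a"
proof -
  let ?g = "cut (- R') (\<lambda>y. K x y - K z y)"
  have a: "a \<ge> 0" by (rule order_trans[OF norm_ge_zero assms(4)])
  have nn: "(\<integral>\<^sup>+y. ennreal (norm (?g y)) \<partial>M) \<le> ennreal C\<^sub>K"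
    using hormander[OF assms(1-3)]
    by (rule order_trans[rotated]) (auto intro!: nn_integral_mono simp: cut_def)
  then have g: "integrable M ?g"
    by (intro integrableI_bounded) (auto simp: le_less_trans)
  have le: "norm (cut (- R') (\<lambda>y. (K x y - K z y) * f y) y) \<le> norm (a * norm (?g y))" for y
    using mult_left_mono[OF assms(4)[of y], of "norm (K x y - K z y)"] a
    by (auto simp: cut_def norm_mult mult.commute)
  show int: "integrable M (cut (- R') (\<lambda>y. (K x y - K z y) * f y))"
    by (rule Bochner_Integration.integrable_bound[of M "\<lambda>y. a * norm (?g y)"])
       (use g le in \<open>auto simp: AE_M_iff\<close>)
  have "(LINT y|M. norm (?g y)) \<le> C\<^sub>K"
    using nn consts_nonneg(2) nn_integral_eq_integral[of M "\<lambda>y. norm (?g y)"] g by simp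
  moreover have "norm (LINT y|M. cut (- R') (\<lambda>y. (K x y - K z y) * f y) y)
      \<le> (LINT y|M. a * norm (?g y))"
  proof (rule order_trans[OF integral_norm_bound integral_mono])
    show "integrable M (\<lambda>y. norm (cut (- R') (\<lambda>y. (K x y - K z y) * f y) y))"
      using int by simp
    show "norm (cut (- R') (\<lambda>y. (K x y - K z y) * f y) y) \<le> a * norm (?g y)" for y
      using le[of y] a by (simp add: abs_mult)
  qed (use g in simp)
  ultimately show "norm (LINT y|M. cut (- R') (\<lambda>y. (K x y - K z y) * f y) y) \<le> C\<^sub>K * a"
    using mult_left_mono[of "LINT y|M. norm (?g y)" C\<^sub>K a] a by (simp add: mult.commute)
qed

text \<open>
  The points \<open>x\<close> and \<open>z\<close> lie in a common \<open>R\<close>; outside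
  \<open>R'\<close> the Hoermander condition gives convergence, and \<open>R' - A\<close>
  contributes a finite sum.
\<close>

lemma kernel_difference_integrable:
  assumes "finite A" "\<And>y. norm (f y) \<le> a"
  shows "integrable M (cut (- A) (\<lambda>y. (K x y - K z y) * f y))"
proof -
  obtain R R' where R: "(R, R') \<in> F" "x \<in> R" "z \<in> R" using F_pair by blast
  let ?k = "\<lambda>y. (K x y - K z y) * f y"
  have fin: "finite R'" using R F_finite by blast
  have "integrable M (cut (- A) (cut (- R') ?k))"
    by (rule Bochner_Integration.integrable_bound
          [OF kernel_difference_integrable_off_dilation(1)[OF R assms(2)]])
       (auto simp: cut_def)
  moreover have "integrable M (cut (R' - A) ?k)"
    using fin finite_support_cut[of "R' - A" ?k] by (intro integrable_finite_support) simp
  ultimately have "integrable M (\<lambda>y. cut (- A) (cut (- R') ?k) y + cut (R' - A) ?k y)"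
    by (rule Bochner_Integration.integrable_add)
  then show ?thesis
    by (rule back_subst[where P = "integrable M"]) (auto simp: cut_def)
qed

definition increment :: "'v set \<Rightarrow> ('v \<Rightarrow> complex) \<Rightarrow> 'v \<Rightarrow> 'v \<Rightarrow> complex" where
  "increment A f x z = T (cut A f) x - T (cut A f) z +
     (LINT y|M. cut (- A) (\<lambda>y. (K x y - K z y) * f y) y)"

text \<open>
  The points of \<open>A' - A\<close> move from the integral to the truncation of
  \<open>f\<close>. Both \<open>x\<close> and \<open>z\<close> are outside this difference, so
  there \<open>T\<close> is given by the kernel and the two changes cancel.
\<close>

lemma increment_mono:
  assumes "finite A'" "A \<subseteq> A'" "x \<in> A" "z \<in> A" "\<And>y. norm (f y) \<le> a"
  shows "increment A f x z = increment A' f x z"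
proof -
  let ?k = "\<lambda>y. (K x y - K z y) * f y" and ?D = "A' - A"
  have fin: "finite A" "finite ?D" using assms finite_subset by auto
  have T_A': "T (cut A' f) u = T (cut A f) u + (LINT y|M. K u y * cut ?D f y)" if "u \<in> A" for u
    using T_cut_union[of A ?D f u] T_off_support[of ?D u f] fin that assms(2)
    by (simp add: Un_absorb1)
  have int: "integrable M (\<lambda>y. K u y * cut ?D f y)" for u
    using fin(2) by (intro integrable_finite_support) (auto simp: cut_def intro: finite_subset[of _ ?D])
  have "(LINT y|M. cut (- A) ?k y) = (LINT y|M. cut (- A') ?k y + (K x y * cut ?D f y - K z y * cut ?D f y))"
    using assms(2) by (intro Bochner_Integration.integral_cong) (auto simp: cut_def algebra_simps)
  also have "\<dots> = (LINT y|M. cut (- A') ?k y) +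
      ((LINT y|M. K x y * cut ?D f y) - (LINT y|M. K z y * cut ?D f y))"
    using int kernel_difference_integrable[OF assms(1,5)]
    by (subst Bochner_Integration.integral_add) (auto simp: Bochner_Integration.integral_diff)
  finally show ?thesis
    unfolding increment_def using T_A'[OF assms(3)] T_A'[OF assms(4)] by simp
qed

lemma increment_add:
  assumes "finite A" "\<And>y. norm (f y) \<le> a"
  shows "increment A f x o' = increment A f x z + increment A f z o'"
proof -
  let ?k = "\<lambda>u v y. (K u y - K v y) * f y"
  have "(LINT y|M. cut (- A) (?k x o') y) = (LINT y|M. cut (- A) (?k x z) y + cut (- A) (?k z o') y)"
    by (intro Bochner_Integration.integral_cong) (auto simp: cut_def algebra_simps)
  also have "\<dots> = (LINT y|M. cut (- A) (?k x z) y) + (LINT y|M. cut (- A) (?k z o') y)"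
    using kernel_difference_integrable[OF assms] by (intro Bochner_Integration.integral_add)
  finally show ?thesis unfolding increment_def by simp
qed

text \<open>
  An arbitrary vertex: another choice changes the extension by a constant.
\<close>

definition basepoint :: 'v where "basepoint = undefined"

text \<open>
  The set \<open>{x, basepoint}\<close> is the smallest admissible one; it could be any finite
  superset.
\<close>

definition extension :: "('v \<Rightarrow> complex) \<Rightarrow> 'v \<Rightarrow> complex" where
  "extension f x = increment {x, basepoint} f x basepoint"

lemma extension_eq:
  assumes "finite A" "x \<in> A" "basepoint \<in> A" "\<And>y. norm (f y) \<le> a"
  shows "extension f x = increment A f x basepoint"
  unfolding extension_def by (rule increment_mono) (use assms in auto)

lemma extension_diff:
  assumes "finite A" "x \<in> A" "z \<in> A" "\<And>y. norm (f y) \<le> a"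
  shows "extension f x = increment A f x z + extension f z"
proof -
  let ?A = "insert basepoint A"
  have "extension f x = increment ?A f x z + increment ?A f z basepoint"
    using assms by (simp add: extension_eq[of ?A x f a] increment_add[of ?A f a x basepoint z])
  moreover have "increment ?A f z basepoint = extension f z"
    using assms by (simp add: extension_eq[of ?A z f a])
  moreover have "increment ?A f x z = increment A f x z"
    using increment_mono[OF _ subset_insertI assms(2-4), of basepoint] assms(1) by simp
  ultimately show ?thesis by simp
qed

lemma extension_add:
  assumes "\<And>y. norm (f y) \<le> a" "\<And>y. norm (g y) \<le> b"
  shows "extension (\<lambda>x. f x + g x) x = extension f x + extension g x"
proof -
  let ?A = "{x, basepoint}" and ?k = "\<lambda>f y. (K x y - K basepoint y) * f y"
  have "(LINT y|M. cut (- ?A) (?k (\<lambda>x. f x + g x)) y) =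
      (LINT y|M. cut (- ?A) (?k f) y + cut (- ?A) (?k g) y)"
    by (intro Bochner_Integration.integral_cong) (auto simp: cut_def algebra_simps)
  also have "\<dots> = (LINT y|M. cut (- ?A) (?k f) y) + (LINT y|M. cut (- ?A) (?k g) y)"
    using assms by (intro Bochner_Integration.integral_add kernel_difference_integrable) auto
  finally show ?thesis
    unfolding extension_def increment_def by (simp add: cut_add T_add L2_cut_finite)
qed

lemma extension_scale: "extension (\<lambda>x. c * f x) x = c * extension f x"
proof -
  let ?A = "{x, basepoint}" and ?k = "\<lambda>f y. (K x y - K basepoint y) * f y"
  have "(LINT y|M. cut (- ?A) (?k (\<lambda>x. c * f x)) y) = (LINT y|M. c * cut (- ?A) (?k f) y)"
    by (intro Bochner_Integration.integral_cong) (auto simp: cut_def algebra_simps)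
  then show ?thesis
    unfolding extension_def increment_def by (simp add: cut_scale T_scale L2_cut_finite algebra_simps)
qed

text \<open>
  The inequality \<open>a t \<le> (a\<^sup>2 + t\<^sup>2) / 2\<close> turns the
  \<open>L\<^sup>1\<close> mean into an \<open>L\<^sup>2\<close> quantity and takes the place of
  the Cauchy-Schwarz inequality: both summands scale like \<open>a\<^sup>2 \<mu>(R)\<close>, so
  nothing is lost except in the constant.
\<close>

lemma local_part_bound:
  assumes "(R, R') \<in> F" "\<And>y. norm (f y) \<le> a"
  shows "(\<Sum>x\<in>R. w x * norm (T (cut R' f) x)) \<le> (1 + C\<^sub>T * C\<^sub>R) / 2 * a * sum w R"
proof -
  let ?g = "cut R' f"
  have fin: "finite R'" "finite R"
    using F_finite[OF assms(1)] finite_subset[OF F_subset[OF assms(1)]] by simp_all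
  have a: "a \<ge> 0" by (rule order_trans[OF norm_ge_zero assms(2)])
  have g: "?g \<in> L2_space M" using fin by (intro L2_cut_finite)
  show ?thesis
  proof (cases "a = 0")
    \<comment> \<open>The estimate below divides by \<open>a\<close>.\<close>
    case True
    then have "?g = (\<lambda>x. 0 * ?g x)" using assms(2) by (auto simp: cut_def)
    from trans[OF arg_cong[OF this, of T] T_scale[OF g]] have "T ?g = (\<lambda>x. 0)" by simp
    then show ?thesis using True by simp
  next
    case False
    with a have a: "a > 0" by simp
    have "(LINT x|M. (norm (?g x))\<^sup>2) = (\<Sum>x\<in>R'. w x * (norm (?g x))\<^sup>2)"
      using fin by (subst integral_finite_support[of R']) (auto simp: cut_def)
    also have "\<dots> \<le> (\<Sum>x\<in>R'. w x * a\<^sup>2)"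
      using assms(2) w_pos by (intro sum_mono mult_left_mono power_mono) (auto simp: cut_def less_imp_le)
    also have "\<dots> = a\<^sup>2 * measure M R'"
      using fin by (simp add: measure_finite flip: sum_distrib_right)
    also have "\<dots> \<le> a\<^sup>2 * (C\<^sub>R * measure M R)"
      using F_measure[OF assms(1)] by (intro mult_left_mono) auto
    finally have g_le: "(LINT x|M. (norm (?g x))\<^sup>2) \<le> a\<^sup>2 * (C\<^sub>R * sum w R)"
      using fin by (simp add: measure_finite)
    have "(\<Sum>x\<in>R. w x * (norm (T ?g x))\<^sup>2) \<le> C\<^sub>T * (LINT x|M. (norm (?g x))\<^sup>2)"
      using sum_le_L2[OF T_L2[OF g] fin(2)] T_bound[OF g] by linarith
    also have "\<dots> \<le> C\<^sub>T * (a\<^sup>2 * (C\<^sub>R * sum w R))"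
      using g_le consts_nonneg by (intro mult_left_mono)
    finally have Tg: "(\<Sum>x\<in>R. w x * (norm (T ?g x))\<^sup>2) \<le> C\<^sub>T * (a\<^sup>2 * (C\<^sub>R * sum w R))" .
    have "a * (\<Sum>x\<in>R. w x * norm (T ?g x)) \<le> (\<Sum>x\<in>R. w x * ((a\<^sup>2 + (norm (T ?g x))\<^sup>2) / 2))"
      unfolding sum_distrib_left
    proof (rule sum_mono)
      fix x
      have "a * norm (T ?g x) \<le> (a\<^sup>2 + (norm (T ?g x))\<^sup>2) / 2"
        using sum_squares_bound[of a "norm (T ?g x)"] by simp
      from mult_left_mono[OF this, of "w x"] w_pos[of x]
      show "a * (w x * norm (T ?g x)) \<le> w x * ((a\<^sup>2 + (norm (T ?g x))\<^sup>2) / 2)"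
        by (simp add: algebra_simps)
    qed
    also have "\<dots> = (sum w R * a\<^sup>2 + (\<Sum>x\<in>R. w x * (norm (T ?g x))\<^sup>2)) / 2"
      by (simp add: distrib_left sum.distrib sum_distrib_right flip: sum_divide_distrib)
    also have "\<dots> \<le> a * ((1 + C\<^sub>T * C\<^sub>R) / 2 * a * sum w R)"
      using Tg by (simp add: algebra_simps power2_eq_square)
    finally show ?thesis using a by simp
  qed
qed

text \<open>
  For a fixed \<open>z\<close> in \<open>R\<close>, the extension differs on \<open>R\<close>
  from \<open>T(f 1\<^bsub>R'\<^esub>)\<close> by the constant \<open>c\<close> below and a
  kernel integral that the Hoermander condition bounds pointwise.
\<close>

lemma extension_oscillation:
  assumes "(R, R') \<in> F" "\<And>y. norm (f y) \<le> a"
  shows "(\<integral>\<^sup>+x\<in>R. ennreal (norm (extension f x - mean_on M R (extension f))) \<partial>M) / emeasure M R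
    \<le> ennreal ((1 + C\<^sub>T * C\<^sub>R + 2 * C\<^sub>K) * a)"
proof (cases "R = {}")
  case True
  then show ?thesis by simp
next
  case False
  then obtain z where z: "z \<in> R" by blast
  let ?g = "cut R' f" and ?E = "extension f"
  have fin: "finite R'" "finite R"
    using F_finite[OF assms(1)] finite_subset[OF F_subset[OF assms(1)]] by simp_all
  have pos: "sum w R > 0" using fin False w_pos by (intro sum_pos) auto
  have a: "a \<ge> 0" by (rule order_trans[OF norm_ge_zero assms(2)])
  define c where "c = ?E z - T ?g z"
  have pt: "norm (?E x - c) \<le> norm (T ?g x) + C\<^sub>K * a" if "x \<in> R" for x
  proof -
    have "?E x = increment R' f x z + ?E z"
      using that z F_subset[OF assms(1)] by (intro extension_diff[OF fin(1) _ _ assms(2)]) auto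
    then have "?E x - c = T ?g x + (LINT y|M. cut (- R') (\<lambda>y. (K x y - K z y) * f y) y)"
      by (simp add: c_def increment_def)
    then show ?thesis
      using kernel_difference_integrable_off_dilation(2)[OF assms(1) that z assms(2)]
      by (auto intro: norm_triangle_le)
  qed
  have "(\<Sum>x\<in>R. w x * norm (?E x - mean_on M R ?E)) \<le> 2 * (\<Sum>x\<in>R. w x * norm (?E x - c))"
    by (rule mean_oscillation_le) (use fin False in auto)
  also have "(\<Sum>x\<in>R. w x * norm (?E x - c)) \<le> (\<Sum>x\<in>R. w x * (norm (T ?g x) + C\<^sub>K * a))"
    using pt w_pos by (intro sum_mono mult_left_mono) (auto simp: less_imp_le)
  also have "\<dots> = (\<Sum>x\<in>R. w x * norm (T ?g x)) + C\<^sub>K * a * sum w R"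
    by (simp add: distrib_left sum.distrib sum_distrib_left mult_ac)
  also have "\<dots> \<le> (1 + C\<^sub>T * C\<^sub>R) / 2 * a * sum w R + C\<^sub>K * a * sum w R"
    using local_part_bound[OF assms] by simp
  finally have "(\<Sum>x\<in>R. w x * norm (?E x - mean_on M R ?E)) \<le>
      (1 + C\<^sub>T * C\<^sub>R + 2 * C\<^sub>K) * a * sum w R"
    by (simp add: field_simps)
  then have "(\<Sum>x\<in>R. w x * norm (?E x - mean_on M R ?E)) / sum w R \<le>
      (1 + C\<^sub>T * C\<^sub>R + 2 * C\<^sub>K) * a"
    using pos by (simp add: pos_divide_le_eq)
  then show ?thesis
    using pos fin w_pos
    by (simp add: nn_set_integral_finite emeasure_finite divide_ennreal sum_nonneg less_imp_le
        ennreal_leI)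
qed

text \<open>
  Along the exhaustion \<open>B\<close> the increment does not change once \<open>B n\<close>
  contains \<open>x\<close> and the base point. Its truncated part tends to \<open>T f(x) - T
  f(b)\<close>, because convergence in \<open>L\<^sup>2\<close> implies pointwise convergence
  when points have positive mass, and its integral tends to 0 by dominated convergence.
\<close>

lemma extension_extends:
  assumes "f \<in> L2_space M" "\<And>y. norm (f y) \<le> a"
  shows "extension f x = T f x - T f basepoint"
proof -
  have T_lim: "(\<lambda>n. T (cut (B n) f) u) \<longlonglongrightarrow> T f u" for u
  proof -
    have sq: "(\<lambda>n. LINT y|M. (norm (cut (- B n) f y))\<^sup>2) \<longlonglongrightarrow> (LINT y|M. 0)"
    proof (rule integral_dominated_convergence)
      show "integrable M (\<lambda>y. (norm (f y))\<^sup>2)" using assms(1) by (simp add: L2_space_iff)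
      have "(\<lambda>n. (norm (cut (- B n) f y))\<^sup>2) \<longlonglongrightarrow> 0" for y
        by (rule tendsto_eventually) (use B_exhausts[of y] in \<open>eventually_elim, simp add: cut_def\<close>)
      then show "AE y in M. (\<lambda>n. (norm (cut (- B n) f y))\<^sup>2) \<longlonglongrightarrow> 0" by simp
    qed (auto simp: cut_def)
    have le: "(norm (T (cut (B n) f) u - T f u))\<^sup>2 \<le>
        C\<^sub>T / w u * (LINT y|M. (norm (cut (- B n) f y))\<^sup>2)" for n
    proof -
      have "f = (\<lambda>y. cut (B n) f y + cut (- B n) f y)" by (auto simp: cut_def)
      then have "T f u = T (cut (B n) f) u + T (cut (- B n) f) u"
        using T_add[OF L2_cut[OF assms(1)] L2_cut[OF assms(1)], of "B n" "- B n"] by metis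
      moreover have "w u * (norm (T (cut (- B n) f) u))\<^sup>2 \<le>
          C\<^sub>T * (LINT y|M. (norm (cut (- B n) f y))\<^sup>2)"
        using point_le_L2[OF T_L2[OF L2_cut[OF assms(1), of "- B n"]], of u]
          T_bound[OF L2_cut[OF assms(1), of "- B n"]] by linarith
      ultimately show ?thesis
        using w_pos[of u] by (simp add: field_simps norm_minus_commute)
    qed
    have "(\<lambda>n. C\<^sub>T / w u * (LINT y|M. (norm (cut (- B n) f y))\<^sup>2)) \<longlonglongrightarrow> 0"
      using tendsto_mult_left[OF sq, of "C\<^sub>T / w u"] by simp
    then have "(\<lambda>n. (norm (T (cut (B n) f) u - T f u))\<^sup>2) \<longlonglongrightarrow> 0"
      by (rule tendsto_sandwich[OF _ _ tendsto_const, rotated 2]) (use le in auto)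
    then have "(\<lambda>n. norm (T (cut (B n) f) u - T f u)) \<longlonglongrightarrow> 0"
      using tendsto_real_sqrt by fastforce
    then show ?thesis using LIM_zero_cancel tendsto_norm_zero_iff by blast
  qed
  let ?k = "\<lambda>y. (K x y - K basepoint y) * f y"
  have "(\<lambda>n. LINT y|M. cut (- B n) ?k y) \<longlonglongrightarrow> (LINT y|M. 0)"
  proof (rule integral_dominated_convergence)
    have "integrable M (cut (- {}) ?k)"
      by (rule kernel_difference_integrable) (use assms(2) in auto)
    then show "integrable M (\<lambda>y. norm (?k y))"
      by (simp add: cut_UNIV)
    have "(\<lambda>n. cut (- B n) ?k y) \<longlonglongrightarrow> 0" for y
      by (rule tendsto_eventually) (use B_exhausts[of y] in \<open>eventually_elim, simp add: cut_def\<close>)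
    then show "AE y in M. (\<lambda>n. cut (- B n) ?k y) \<longlonglongrightarrow> 0" by simp
  qed (auto simp: cut_def)
  then have "(\<lambda>n. increment (B n) f x basepoint) \<longlonglongrightarrow> T f x - T f basepoint + 0"
    unfolding increment_def by (intro tendsto_intros T_lim) simp
  moreover have "(\<lambda>n. increment (B n) f x basepoint) \<longlonglongrightarrow> extension f x"
  proof (rule tendsto_eventually)
    show "\<forall>\<^sub>F n in sequentially. increment (B n) f x basepoint = extension f x"
      using B_exhausts[of x] B_exhausts[of basepoint]
      by eventually_elim (simp add: extension_eq[OF B_finite _ _ assms(2)])
  qed
  ultimately show ?thesis by (simp add: LIMSEQ_unique)
qed

end


section \<open>Walks in connected and acyclic graphs\<close>

lemma walk_iff_relpowp: "(\<exists>p. walk adj x p y \<and> length p = Suc n) \<longleftrightarrow> (adj ^^ n) x y"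
proof (induction n arbitrary: x)
  case 0
  then show ?case by (auto simp: walk_def length_Suc_conv)
next
  case (Suc n)
  have "(\<exists>p. walk adj x p y \<and> length p = Suc (Suc n)) \<longleftrightarrow>
        (\<exists>z. adj x z \<and> (\<exists>p. walk adj z p y \<and> length p = Suc n))"
  proof safe
    fix p assume p: "walk adj x p y" "length p = Suc (Suc n)"
    then obtain z q where "p = x # z # q" by (auto simp: walk_def length_Suc_conv)
    with p show "\<exists>z. adj x z \<and> (\<exists>p. walk adj z p y \<and> length p = Suc n)"
      by (intro exI[of _ z] conjI exI[of _ "z # q"]) (auto simp: walk_def)
  next
    fix z p assume "adj x z" "walk adj z p y" "length p = Suc n"
    then show "\<exists>p. walk adj x p y \<and> length p = Suc (Suc n)"
      by (intro exI[of _ "x # p"]) (auto simp: walk_def successively_Cons)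
  qed
  then show ?case
    unfolding Suc.IH by (metis relpowp_Suc_D2 relpowp_Suc_I2)
qed

lemma gdist_eq_Least: "gdist adj x y = (LEAST n. (adj ^^ n) x y)"
  unfolding gdist_def walk_iff_relpowp ..

text \<open>
  Being joined inside \<open>A\<close>, in a form that allows induction along the relation
  instead of surgery on lists.
\<close>

abbreviation linked_in :: "('v \<Rightarrow> 'v \<Rightarrow> bool) \<Rightarrow> 'v set \<Rightarrow> 'v \<Rightarrow> 'v \<Rightarrow> bool" where
  "linked_in adj A \<equiv> (\<lambda>u v. adj u v \<and> u \<in> A \<and> v \<in> A)\<^sup>*\<^sup>*"

lemma walk_imp_linked_in:
  assumes "walk adj x p y" "set p \<subseteq> A"
  shows "linked_in adj A x y"
  using assms
proof (induction p arbitrary: x)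
  case Nil
  then show ?case by (simp add: walk_def)
next
  case (Cons a p)
  show ?case
  proof (cases "p = []")
    case True
    with Cons.prems show ?thesis by (auto simp: walk_def)
  next
    case False
    with Cons.prems have "adj x (hd p)" "x \<in> A" "hd p \<in> A" "walk adj (hd p) p y"
      by (auto simp: walk_def successively_Cons)
    moreover have "linked_in adj A (hd p) y"
      using Cons calculation by auto
    ultimately show ?thesis
      by (metis (mono_tags, lifting) converse_rtranclp_into_rtranclp)
  qed
qed

text \<open>
  A walk is prolonged backwards one vertex at a time; when the new vertex has been visited
  already, the loop that would arise is dropped.
\<close>

lemma linked_in_imp_distinct_walk:
  assumes "linked_in adj A x y" "y \<in> A"
  shows "\<exists>p. walk adj x p y \<and> set p \<subseteq> A \<and> distinct p"
  using assms(1)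
proof (induction rule: converse_rtranclp_induct)
  case base
  show ?case using assms(2) by (intro exI[of _ "[y]"]) (auto simp: walk_def)
next
  case (step u v)
  then obtain p where p: "walk adj v p y" "set p \<subseteq> A" "distinct p" by blast
  show ?case
  proof (cases "u \<in> set p")
    case True
    then obtain as bs where "p = as @ u # bs" by (auto dest: split_list)
    with p show ?thesis
      by (intro exI[of _ "u # bs"]) (auto simp: walk_def successively_append_iff)
  next
    case False
    with p step(1) show ?thesis
      by (intro exI[of _ "u # p"]) (auto simp: walk_def successively_Cons)
  qed
qed

lemma connected_in_iff_linked_in:
  "connected_in adj A \<longleftrightarrow> (\<forall>x\<in>A. \<forall>y\<in>A. linked_in adj A x y)"
proof -
  have "linked_in adj A x y \<longleftrightarrow> (\<exists>p. walk adj x p y \<and> set p \<subseteq> A)" if "y \<in> A" for x y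
    using walk_imp_linked_in[of adj x _ y A] linked_in_imp_distinct_walk[OF _ that, of adj x] by blast
  then show ?thesis unfolding connected_in_def by simp
qed

lemma connected_in_via_centre:
  assumes "symp adj" "\<And>x. x \<in> A \<Longrightarrow> linked_in adj A x c"
  shows "connected_in adj A"
proof -
  have "symp (linked_in adj A)"
    by (rule symp_rtranclp) (use assms(1) in \<open>auto simp: symp_def\<close>)
  then have from_c: "linked_in adj A c y" if "y \<in> A" for y
    by (rule sympD) (rule assms(2)[OF that])
  have "linked_in adj A x y" if "x \<in> A" "y \<in> A" for x y
    by (rule rtranclp_trans[OF assms(2)[OF that(1)] from_c[OF that(2)]])
  then show ?thesis unfolding connected_in_iff_linked_in by blast
qed

lemma linked_in_mono:
  assumes "linked_in adj A x y" "A \<subseteq> B"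
  shows "linked_in adj B x y"
  using assms(1)
proof (rule rtranclp_mono[THEN predicate2D, rotated])
  show "(\<lambda>u v. adj u v \<and> u \<in> A \<and> v \<in> A) \<le> (\<lambda>u v. adj u v \<and> u \<in> B \<and> v \<in> B)"
    using assms(2) by blast
qed

lemma connected_in_insert:
  assumes "symp adj" "connected_in adj A" "a \<in> A" "adj a z"
  shows "connected_in adj (insert z A)"
proof (rule connected_in_via_centre[OF assms(1), where c = a])
  fix x assume "x \<in> insert z A"
  then show "linked_in adj (insert z A) x a"
  proof
    assume "x = z"
    with assms(3) sympD[OF assms(1,4)] show ?thesis by (intro r_into_rtranclp) simp
  next
    assume "x \<in> A"
    with assms(2,3) have "linked_in adj A x a" unfolding connected_in_iff_linked_in by blast
    then show ?thesis by (rule linked_in_mono) blast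
  qed
qed

text \<open>
  Two different neighbours of \<open>y\<close> in \<open>C\<close> would be joined by a path
  inside \<open>C\<close>, and together with \<open>y\<close> it would close up to a cycle. This
  is the only way in which acyclicity is used.
\<close>

lemma acyclic_unique_neighbour:
  assumes "symp adj" "acyclic_graph adj" "connected_in adj C"
    and "y \<notin> C" "a \<in> C" "b \<in> C" "adj y a" "adj y b"
  shows "a = b"
proof (rule ccontr)
  assume "a \<noteq> b"
  have "linked_in adj C a b"
    using assms(3,5,6) unfolding connected_in_iff_linked_in by blast
  from linked_in_imp_distinct_walk[OF this assms(6)]
  obtain p where p: "walk adj a p b" "set p \<subseteq> C" "distinct p" by blast
  have "length p \<ge> 2"
    using p(1) \<open>a \<noteq> b\<close> unfolding walk_def
    by (cases p rule: remdups_adj.cases) simp_all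
  then have "3 \<le> length (y # p) \<and> distinct (y # p) \<and> successively adj (y # p) \<and>
        adj (last (y # p)) (hd (y # p))"
    using p assms(4,7) sympD[OF assms(1,8)] by (auto simp: walk_def successively_Cons)
  with assms(2) show False unfolding acyclic_graph_def by blast
qed

locale connected_graph =
  fixes adj :: "'v \<Rightarrow> 'v \<Rightarrow> bool"
  assumes sym: "symp adj" and conn: "connected_in adj UNIV"
begin

lemma adj_sym: "adj x y \<longleftrightarrow> adj y x"
  using sympD[OF sym] by blast

lemma gdist_path: "(adj ^^ gdist adj x y) x y"
proof -
  obtain p where "walk adj x p y"
    using conn unfolding connected_in_def by blast
  then have "\<exists>n. (adj ^^ n) x y"
    by (metis walk_iff_relpowp walk_def length_greater_0_conv gr0_implies_Suc)
  then show ?thesis unfolding gdist_eq_Least by (metis LeastI_ex)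
qed

lemma gdist_le: "(adj ^^ n) x y \<Longrightarrow> gdist adj x y \<le> n"
  unfolding gdist_eq_Least by (rule Least_le)

lemma gdist_eq_0_iff: "gdist adj x y = 0 \<longleftrightarrow> x = y"
  by (metis gdist_le gdist_path le_zero_eq relpowp_0_E relpowp_0_I)

lemma gdist_adj_le: "adj x w \<Longrightarrow> gdist adj x y \<le> Suc (gdist adj w y)"
  by (meson gdist_le gdist_path relpowp_Suc_I2)

lemma gdist_step:
  assumes "gdist adj x y = Suc n"
  obtains w where "adj x w" "gdist adj w y = n"
proof -
  obtain w where w: "adj x w" "(adj ^^ n) w y"
    by (metis assms gdist_path relpowp_Suc_E2)
  then have "gdist adj w y = n"
    using gdist_le gdist_adj_le[of x w y] assms by (metis Suc_le_mono le_antisym)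
  with w that show ?thesis by blast
qed

end

section \<open>Every vertex has one upper neighbour\<close>

locale levelled_tree = connected_graph adj
  for adj :: "'v \<Rightarrow> 'v \<Rightarrow> bool" +
  fixes m :: nat and G :: "'v set" and N :: "'v \<Rightarrow> int"
  assumes tree: "homogeneous_tree m adj" and m_ge: "m \<ge> 1"
    and geo: "infinite_geodesic adj G"
    and N_iso: "\<forall>x\<in>G. \<forall>y\<in>G. \<bar>N x - N y\<bar> = int (gdist adj x y)"
begin

abbreviation "lev \<equiv> level adj G N"

definition foot :: "'v \<Rightarrow> 'v" where "foot x = arg_min_on (gdist adj x) G"

definition depth :: "'v \<Rightarrow> nat" where "depth x = gdist adj x (foot x)"

lemma level_eq: "lev x = N (foot x) - int (depth x)"
  by (simp add: level_def foot_def depth_def Let_def)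

lemma acyclic: "acyclic_graph adj"
  using tree by (simp add: homogeneous_tree_def)

lemma adj_neq: "adj x y \<Longrightarrow> x \<noteq> y"
  using tree unfolding homogeneous_tree_def by (metis irreflpD)

lemma foot_in: "foot x \<in> G"
  using geo arg_min_natI[of "\<lambda>y. y \<in> G"] unfolding foot_def arg_min_on_def infinite_geodesic_def
  by blast

lemma depth_le: "g \<in> G \<Longrightarrow> depth x \<le> gdist adj x g"
  unfolding depth_def foot_def arg_min_on_def by (rule arg_min_nat_le)

lemma depth_eq_0_iff: "depth x = 0 \<longleftrightarrow> x \<in> G"
  by (metis depth_def depth_le foot_in gdist_eq_0_iff le_zero_eq)

lemma foot_eq: "x \<in> G \<Longrightarrow> foot x = x"
  by (metis depth_def depth_eq_0_iff gdist_eq_0_iff)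

lemma depth_adj_le: "adj x w \<Longrightarrow> depth x \<le> Suc (depth w)"
  unfolding depth_def[of w]
  by (meson depth_le foot_in gdist_adj_le le_trans)

lemma depth_step:
  assumes "g \<in> G" "gdist adj x g = depth x" "depth x = Suc n"
  obtains w where "adj x w" "depth w = n" "gdist adj w g = n"
proof -
  obtain w where w: "adj x w" "gdist adj w g = n"
    using gdist_step assms by metis
  then have "depth w = n"
    using depth_le[OF assms(1), of w] depth_adj_le[of x w] assms(3) by simp
  with w that show ?thesis by blast
qed

text \<open>
  Every vertex reaches the geodesic by a path along which \<open>depth\<close> decreases.
\<close>

lemma connected_in_sublevel: "connected_in adj {x. depth x \<le> n}"
proof -
  obtain c where c: "c \<in> G" using foot_in by blast
  have "linked_in adj {x. depth x \<le> n} x c" if "depth x \<le> n" for x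
    using that
  proof (induction n arbitrary: x)
    case 0
    have "linked_in adj G x c"
      using 0 c geo by (auto simp: infinite_geodesic_def connected_in_iff_linked_in depth_eq_0_iff)
    then show ?case by (rule linked_in_mono) (auto simp: depth_eq_0_iff)
  next
    case (Suc n)
    show ?case
    proof (cases "depth x \<le> n")
      case True
      show ?thesis by (rule linked_in_mono[OF Suc.IH[OF True]]) auto
    next
      case False
      with Suc.prems have x: "depth x = Suc n" by simp
      obtain w where w: "adj x w" "depth w = n"
        using depth_step[OF foot_in _ x] depth_def by metis
      have "linked_in adj {x. depth x \<le> Suc n} w c"
        by (rule linked_in_mono[OF Suc.IH]) (use w in auto)
      then show ?thesis
        using w x by (auto intro: converse_rtranclp_into_rtranclp[where b = w])
    qed
  qed
  then show ?thesis by (intro connected_in_via_centre[OF sym, where c = c]) auto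
qed

lemma inner_neighbour_unique:
  assumes "depth x = Suc n" "adj x a" "adj x b" "depth a \<le> n" "depth b \<le> n"
  shows "a = b"
  using acyclic_unique_neighbour[OF sym acyclic connected_in_sublevel[of n], of x a b] assms
  by simp

text \<open>
  Besides \<open>y\<close>, the vertex \<open>x\<close> has a neighbour \<open>v\<close> of
  depth \<open>n\<close>. If \<open>y\<close> had the depth of \<open>x\<close>, it could be
  attached to the sublevel set without destroying connectedness, and \<open>x\<close> would have
  the two neighbours \<open>v\<close> and \<open>y\<close> in the resulting set.
\<close>

lemma depth_adj_neq:
  assumes "depth x = Suc n" "adj x y"
  shows "depth y \<noteq> Suc n"
proof
  assume y: "depth y = Suc n"
  obtain v where v: "adj x v" "depth v = n"
    using depth_step[OF foot_in _ assms(1)] depth_def by metis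
  obtain w where w: "adj y w" "depth w = n"
    using depth_step[OF foot_in _ y] depth_def by metis
  have "x \<noteq> y" using assms(2) by (rule adj_neq)
  have "v = y"
  proof (rule acyclic_unique_neighbour[OF sym acyclic])
    show "connected_in adj (insert y {x. depth x \<le> n})"
      using w adj_sym by (intro connected_in_insert[OF sym connected_in_sublevel, of w]) auto
  qed (use v w y assms \<open>x \<noteq> y\<close> in auto)
  with v y show False by simp
qed

text \<open>
  By induction on the depth: shortest paths to the geodesic all start with the unique inner
  neighbour. Hence \<open>foot\<close>, although selected by choice, is constant along such a
  path.
\<close>

lemma closest_point_unique:
  assumes "g \<in> G" "gdist adj x g = depth x"
  shows "g = foot x"
proof -
  have "g = g'" if "g \<in> G" "gdist adj x g = depth x" "g' \<in> G" "gdist adj x g' = depth x" for g g'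
    using that
  proof (induction "depth x" arbitrary: x)
    case 0
    then show ?case by (metis gdist_eq_0_iff)
  next
    case (Suc n)
    obtain v where v: "adj x v" "depth v = n" "gdist adj v g = n"
      using depth_step Suc by metis
    obtain w where w: "adj x w" "depth w = n" "gdist adj w g' = n"
      using depth_step Suc by metis
    have "v = w" using inner_neighbour_unique[of x n v w] v w Suc by simp
    then show ?case using Suc.hyps(1)[of v] v w Suc.prems by auto
  qed
  then show ?thesis using assms foot_in depth_def by metis
qed

text \<open>
  The shortest path from \<open>x\<close> to its foot passes through \<open>w\<close>, so both
  have the same foot.
\<close>

lemma level_outward:
  assumes "adj x w" "depth x = Suc (depth w)"
  shows "lev w = lev x + 1"
proof -
  obtain v where v: "adj x v" "depth v = depth w" "gdist adj v (foot x) = depth w"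
    using depth_step[OF foot_in _ assms(2)] depth_def by metis
  have "v = w" using inner_neighbour_unique[OF assms(2) v(1) assms(1)] v by simp
  then have "foot x = foot w" using v closest_point_unique[OF foot_in, of w x] by simp
  with assms show ?thesis by (simp add: level_eq)
qed

text \<open>
  Off the geodesic the upper neighbour is the inner one. On the geodesic, the two neighbours in
  \<open>G\<close> have different values of \<open>N\<close>, each differing by 1 from the value
  at \<open>x\<close>, so one of them is higher; the neighbours outside \<open>G\<close> hang
  down.
\<close>

lemma unique_upper_neighbour: "\<exists>!y. adj x y \<and> lev y = lev x + 1"
  and level_adj: "adj x y \<Longrightarrow> lev y = lev x + 1 \<or> lev y = lev x - 1"
proof -
  have "(\<exists>!y. adj x y \<and> lev y = lev x + 1) \<and>
        (\<forall>y. adj x y \<longrightarrow> lev y = lev x + 1 \<or> lev y = lev x - 1)"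
  proof (cases "depth x")
    case (Suc n)
    obtain w where w: "adj x w" "depth w = n"
      using depth_step[OF foot_in _ Suc] depth_def by metis
    have other: "lev y = lev x - 1" if "adj x y" "y \<noteq> w" for y
    proof -
      have "depth y = Suc (depth x)"
        using inner_neighbour_unique[OF Suc that(1) w(1)] depth_adj_neq[OF Suc that(1)]
          depth_adj_le[of y x] depth_adj_le[of x y] that adj_sym w Suc by force
      then show ?thesis using level_outward[of y x] that adj_sym by force
    qed
    have "lev w = lev x + 1" using level_outward[of x w] w Suc by simp
    with w other show ?thesis by (intro conjI ex1I[of _ w]) fastforce+
  next
    case 0
    then have x: "x \<in> G" by (simp add: depth_eq_0_iff)
    have lev_G: "lev g = N g" if "g \<in> G" for g
      using that by (simp add: level_eq foot_eq depth_eq_0_iff[THEN iffD2])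
    have gd: "gdist adj x y = 1" if "adj x y" for y
    proof -
      have "x \<noteq> y" using that by (rule adj_neq)
      moreover have "gdist adj x y \<le> 1" using that by (intro gdist_le) (simp only: relpowp_1)
      ultimately show ?thesis using gdist_eq_0_iff[of x y] by linarith
    qed
    have N1: "N y = N x + 1 \<or> N y = N x - 1" if "adj x y" "y \<in> G" for y
      using N_iso x that gd[OF that(1)] by fastforce
    have N_inj: "y = z" if "y \<in> G" "z \<in> G" "N y = N z" for y z
      using N_iso that gdist_eq_0_iff by fastforce
    have "card {y\<in>G. adj x y} = 2" using geo x by (simp add: infinite_geodesic_def)
    then obtain a b where ab: "{y\<in>G. adj x y} = {a, b}" "a \<noteq> b" by (auto simp: card_2_iff)
    have a: "a \<in> G" "adj x a" and b: "b \<in> G" "adj x b" using ab by blast+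
    have "\<exists>u\<in>G. adj x u \<and> N u = N x + 1"
      using N1[of a] N1[of b] a b N_inj[of a b] ab(2) by metis
    then obtain u where u: "u \<in> G" "adj x u" "N u = N x + 1" by blast
    have out: "lev y = lev x - 1" if "adj x y" "y \<notin> G" for y
    proof -
      have "depth y = Suc (depth x)"
        using depth_adj_le[of y x] that adj_sym 0 depth_eq_0_iff[of y] by fastforce
      then show ?thesis using level_outward[of y x] that adj_sym by force
    qed
    show ?thesis
    proof (intro conjI allI impI)
      show "\<exists>!y. adj x y \<and> lev y = lev x + 1"
      proof (rule ex1I[of _ u])
        fix y assume y: "adj x y \<and> lev y = lev x + 1"
        then have "y \<in> G" using out[of y] by fastforce
        then show "y = u" using y u x N_inj[of y u] lev_G by simp
      qed (use u x lev_G in auto)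
      fix y assume "adj x y"
      then show "lev y = lev x + 1 \<or> lev y = lev x - 1"
        using out[of y] N1[of y] lev_G x by metis
    qed
  qed
  then show "\<exists>!y. adj x y \<and> lev y = lev x + 1"
    "adj x y \<Longrightarrow> lev y = lev x + 1 \<or> lev y = lev x - 1" by blast+
qed

definition parent :: "'v \<Rightarrow> 'v" where
  "parent x = (THE y. adj x y \<and> lev y = lev x + 1)"

lemma parent: "adj x (parent x)" "lev (parent x) = lev x + 1"
  and parent_eq: "adj x y \<Longrightarrow> lev y = lev x + 1 \<Longrightarrow> y = parent x"
  using theI'[OF unique_upper_neighbour[of x]] unique_upper_neighbour[of x]
  unfolding parent_def by blast+

lemma adj_iff_parent: "adj x y \<longleftrightarrow> y = parent x \<or> x = parent y"
  using level_adj[of x y] parent_eq[of x y] parent_eq[of y x] parent(1) adj_sym by auto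

lemma card_children: "card {y. parent y = x} = m"
proof -
  have "{y. adj x y} = insert (parent x) {y. parent y = x}"
    by (auto simp: adj_iff_parent)
  moreover have "card {y. adj x y} = m + 1" using tree by (simp add: homogeneous_tree_def)
  moreover from this have "finite {y. adj x y}" by (metis add_is_0 card.infinite one_neq_zero)
  moreover have "parent x \<notin> {y. parent y = x}"
    using parent(2)[of x] parent(2)[of "parent x"] by auto
  ultimately show ?thesis by simp
qed

end


section \<open>Calderon-Zygmund sets in terms of the parent map\<close>

text \<open>
  The tree as seen from its end at infinity above: adjacency is generated by the parent map, and
  the geodesic has disappeared.
\<close>

locale rooted_at_infinity = connected_graph adj
  for adj :: "'v \<Rightarrow> 'v \<Rightarrow> bool" +
  fixes m :: nat and lev :: "'v \<Rightarrow> int" and par :: "'v \<Rightarrow> 'v"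
  assumes m_ge: "m \<ge> 1"
    and adj_iff: "adj x y \<longleftrightarrow> y = par x \<or> x = par y"
    and lev_par: "lev (par x) = lev x + 1"
    and card_children: "card {y. par y = x} = m"
begin

lemma lev_funpow: "lev ((par ^^ k) x) = lev x + int k"
  by (induction k) (simp_all add: lev_par)

lemma relpowp_funpow: "(adj ^^ k) x ((par ^^ k) x)"
  by (induction k) (auto simp: adj_iff)

lemma lev_relpowp: "(adj ^^ n) x y \<Longrightarrow> lev y \<le> lev x + int n"
proof (induction n arbitrary: y)
  case (Suc n)
  then obtain z where z: "(adj ^^ n) x z" "adj z y" by auto
  from Suc.IH[OF z(1)] z(2) show ?case using lev_par[of z] lev_par[of y] by (auto simp: adj_iff)
qed simp

text \<open>
  A step changes the level by 1, so a path that gains \<open>n\<close> levels in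
  \<open>n\<close> steps goes to the parent each time.
\<close>

lemma steepest_path:
  assumes "(adj ^^ n) x y" "lev y = lev x + int n"
  shows "(par ^^ n) x = y"
  using assms
proof (induction n arbitrary: y)
  case (Suc n)
  then obtain z where z: "(adj ^^ n) x z" "adj z y" by auto
  have y: "y = par z"
    using z lev_relpowp[OF z(1)] Suc.prems(2) lev_par[of y] by (auto simp: adj_iff)
  then have "lev z = lev x + int n" using Suc.prems(2) lev_par[of z] by simp
  from Suc.IH[OF z(1) this] y show ?case by simp
qed simp

lemma lies_below_iff_funpow:
  "lies_below adj lev x y \<and> lev y - lev x = int k \<longleftrightarrow> (par ^^ k) x = y"
proof
  assume *: "lies_below adj lev x y \<and> lev y - lev x = int k"
  then have "gdist adj x y = k" by (simp add: lies_below_def)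
  with gdist_path[of x y] * show "(par ^^ k) x = y" by (intro steepest_path) auto
next
  assume *: "(par ^^ k) x = y"
  have "gdist adj x y = k"
    using gdist_le[OF relpowp_funpow[of k x]] lev_relpowp[OF gdist_path[of x y]] lev_funpow[of k x] *
    by simp
  then show "lies_below adj lev x y \<and> lev y - lev x = int k"
    using lev_funpow[of k x] * by (simp add: lies_below_def)
qed

definition descendants :: "'v \<Rightarrow> nat \<Rightarrow> 'v set" where
  "descendants r k = {x. (par ^^ k) x = r}"

lemma finite_children: "finite {y. par y = x}"
  using card_children[of x] m_ge by (intro card_ge_0_finite) simp

lemma descendants_Suc: "descendants r (Suc k) = (\<Union>y\<in>descendants r k. {x. par x = y})"
  unfolding descendants_def by (auto simp: funpow_swap1)

lemma finite_descendants: "finite (descendants r k)"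
  by (induction k) (simp_all add: descendants_Suc finite_children, simp add: descendants_def)

lemma card_descendants: "card (descendants r k) = m ^ k"
proof (induction k)
  case 0
  then show ?case by (simp add: descendants_def)
next
  case (Suc k)
  have "card (descendants r (Suc k)) = (\<Sum>y\<in>descendants r k. card {x. par x = y})"
    unfolding descendants_Suc
    by (rule card_UN_disjoint) (auto simp: finite_descendants finite_children)
  with Suc show ?case by (simp add: card_children)
qed

lemma lev_descendants: "x \<in> descendants r k \<Longrightarrow> lev x = lev r - int k"
  using lev_funpow[of k x] by (auto simp: descendants_def)

lemma disjoint_descendants: "j \<noteq> k \<Longrightarrow> descendants r j \<inter> descendants r k = {}"
  using lev_descendants[of _ r j] lev_descendants[of _ r k] by force

lemma cz_set_eq_descendants:
  "{x. lies_below adj lev x r \<and> real h / 2 \<le> real_of_int (lev r - lev x) \<and>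
       lev r - lev x < 4 * int h} = (\<Union>k\<in>{k. h \<le> 2 * k \<and> k < 4 * h}. descendants r k)"
    (is "?L = ?R")
proof (intro equalityI subsetI)
  fix x assume "x \<in> ?L"
  then have x: "lies_below adj lev x r" "real h / 2 \<le> real_of_int (lev r - lev x)"
    "lev r - lev x < 4 * int h" by auto
  from x(1) obtain k where k: "lev r - lev x = int k"
    by (auto simp: lies_below_def)
  with x(1) have "x \<in> descendants r k"
    using lies_below_iff_funpow[of x r k] by (simp add: descendants_def)
  moreover have "h \<le> 2 * k" "k < 4 * h" using x(2,3) unfolding k by linarith+
  ultimately show "x \<in> ?R" by blast
next
  fix x assume "x \<in> ?R"
  then obtain k where k: "h \<le> 2 * k" "k < 4 * h" "(par ^^ k) x = r"
    by (auto simp: descendants_def)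
  then have "lies_below adj lev x r \<and> lev r - lev x = int k"
    using lies_below_iff_funpow by blast
  with k(1,2) show "x \<in> ?L" by simp
qed

text \<open>
  A path of at most \<open>k\<close> steps that starts \<open>k\<close> generations below
  \<open>r\<close> cannot leave the subtree of \<open>r\<close>, because its only exit is
  through \<open>r\<close>.
\<close>

lemma near_descendants:
  assumes "(adj ^^ n) x y" "y \<in> descendants r k" "n \<le> k"
  shows "\<exists>j \<le> k + n. k \<le> j + n \<and> x \<in> descendants r j"
  using assms
proof (induction n arbitrary: x)
  case (Suc n)
  then obtain z where z: "adj x z" "(adj ^^ n) z y" by (metis relpowp_Suc_D2)
  with Suc obtain j where j: "j \<le> k + n" "k \<le> j + n" "(par ^^ j) z = r"
    by (auto simp: descendants_def)
  from z(1) consider "z = par x" | "x = par z" by (auto simp: adj_iff)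
  then show ?case
  proof cases
    case 1
    with j show ?thesis
      by (intro exI[of _ "Suc j"]) (auto simp: descendants_def funpow_swap1)
  next
    case 2
    obtain i where "j = Suc i" using j(2) Suc.prems(3) by (cases j) auto
    with 2 j show ?thesis
      by (intro exI[of _ i]) (auto simp: descendants_def funpow_swap1)
  qed
qed auto

text \<open>
  A point of \<open>R\<close> is at least \<open>h/2\<close> generations below \<open>r\<close>,
  which is more than the \<open>h/4\<close> steps available to leave it; so the dilation stays
  below \<open>r\<close>, in generations less than \<open>4 h + h/4 < 5 h\<close>.
\<close>

lemma cz_dilation_subset_descendants:
  assumes "cz_dilation adj R h = R'" "R = (\<Union>k\<in>{k. h \<le> 2 * k \<and> k < 4 * h}. descendants r k)" "h \<ge> 1"
  shows "R' \<subseteq> (\<Union>j<5 * h. descendants r j)"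
proof
  fix x assume "x \<in> R'"
  then have lt: "real (INF y\<in>R. gdist adj x y) < real h / 4"
    using assms(1) by (auto simp: cz_dilation_def)
  have "descendants r h \<noteq> {}" using card_descendants[of r h] m_ge by auto
  then have "R \<noteq> {}" using assms(2,3) by auto
  then have "(INF y\<in>R. gdist adj x y) \<in> gdist adj x ` R" by (intro Inf_nat_def1) simp
  then obtain y where y: "y \<in> R" "real (gdist adj x y) < real h / 4" using lt by auto
  then obtain k where k: "h \<le> 2 * k" "k < 4 * h" "y \<in> descendants r k" using assms(2) by auto
  have "4 * gdist adj x y < h" using y(2) by linarith
  moreover from this obtain j where "j \<le> k + gdist adj x y" "x \<in> descendants r j"
    using near_descendants[OF gdist_path[of x y] k(3)] k(1) by auto
  ultimately show "x \<in> (\<Union>j<5 * h. descendants r j)" using k by (intro UN_I[of j]) auto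
qed

lemma cz_dilation_singleton: "cz_dilation adj {x} 1 = {x}"
proof -
  have "real (gdist adj y x) < 1 / 4 \<longleftrightarrow> gdist adj y x = 0" for y by linarith
  then show ?thesis by (simp add: cz_dilation_def gdist_eq_0_iff)
qed

lemma subset_cz_dilation: "h \<ge> 1 \<Longrightarrow> R \<subseteq> cz_dilation adj R h"
proof
  fix x assume x: "x \<in> R" "h \<ge> 1"
  then have "(INF y\<in>R. gdist adj x y) \<le> gdist adj x x" by (intro cINF_lower) auto
  then have "(INF y\<in>R. gdist adj x y) = 0" by (metis gdist_eq_0_iff le_zero_eq)
  with x show "x \<in> cz_dilation adj R h" by (simp add: cz_dilation_def)
qed

definition weight :: "'v \<Rightarrow> real" where "weight x = real m powi lev x"

sublocale weighted_points weight
  by unfold_locales (use m_ge in \<open>simp add: weight_def\<close>)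

lemma M_eq: "M = level_measure m lev"
  by (simp add: M_def level_measure_def weight_def)

text \<open>
  The number \<open>m\<^sup>k\<close> of descendants compensates the factor
  \<open>m\<^bsup>-k\<^esup>\<close> in the weight, so that all generations have equal mass.
\<close>

lemma sum_weight_descendants: "sum weight (descendants r k) = weight r"
proof -
  have "sum weight (descendants r k) = (\<Sum>x\<in>descendants r k. real m powi (lev r - int k))"
    by (intro sum.cong) (simp_all add: weight_def lev_descendants)
  also have "\<dots> = real m ^ k * real m powi (lev r - int k)"
    by (simp add: card_descendants)
  also have "\<dots> = weight r"
    using m_ge by (simp add: weight_def power_int_diff)
  finally show ?thesis .
qed

lemma measure_descendants:
  "finite I \<Longrightarrow> measure M (\<Union>k\<in>I. descendants r k) = real (card I) * weight r"
  by (subst measure_finite)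
     (simp_all add: finite_descendants sum.UNION_disjoint disjoint_descendants sum_weight_descendants)

lemma cz_set_cases:
  assumes "cz_set adj lev R h"
  obtains x where "R = {x}" "cz_dilation adj R h = {x}"
  | r where "h \<ge> 1" "R = (\<Union>k\<in>{k. h \<le> 2 * k \<and> k < 4 * h}. descendants r k)"
      "cz_dilation adj R h \<subseteq> (\<Union>j<5 * h. descendants r j)"
proof -
  from assms consider x where "R = {x}" "h = 1"
    | r where "h \<ge> 1" "R = (\<Union>k\<in>{k. h \<le> 2 * k \<and> k < 4 * h}. descendants r k)"
    unfolding cz_set_def cz_set_eq_descendants by blast
  then show thesis
  proof cases
    case 1
    then show thesis using cz_dilation_singleton that(1) by blast
  next
    case 2
    then show thesis using cz_dilation_subset_descendants[OF refl 2(2,1)] that(2) by blast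
  qed
qed

lemma finite_cz_dilation: "cz_set adj lev R h \<Longrightarrow> finite (cz_dilation adj R h)"
  by (erule cz_set_cases) (auto intro: finite_subset simp: finite_descendants)

lemma cz_set_h_ge: "cz_set adj lev R h \<Longrightarrow> h \<ge> 1"
  by (auto simp: cz_set_def)

text \<open>
  The measures count generations: \<open>R\<close> has at least the \<open>3 h\<close>
  generations from \<open>h\<close> to \<open>4 h - 1\<close>, its dilation at most \<open>5
  h\<close>, and \<open>5 h \<le> 2 (3 h)\<close>.
\<close>

lemma measure_cz_dilation:
  assumes "cz_set adj lev R h"
  shows "measure M (cz_dilation adj R h) \<le> 2 * measure M R"
  using assms
proof (cases rule: cz_set_cases)
  case (1 x)
  then show ?thesis by (simp add: measure_nonneg)
next
  case (2 r)
  let ?I = "{k. h \<le> 2 * k \<and> k < 4 * h}"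
  have fin: "finite ?I" by (rule finite_subset[of _ "{..<4 * h}"]) auto
  have "{h..<4 * h} \<subseteq> ?I" by auto
  from card_mono[OF fin this] have I: "3 * h \<le> card ?I" by simp
  have "measure M (cz_dilation adj R h) \<le> measure M (\<Union>j<5 * h. descendants r j)"
    using 2(3) finite_cz_dilation[OF assms]
    by (simp add: measure_finite finite_descendants sum_mono2 w_pos less_imp_le)
  also have "\<dots> = real (5 * h) * weight r"
    using measure_descendants[of "{..<5 * h}" r] by simp
  also have "\<dots> \<le> 2 * (real (card ?I) * weight r)"
    using I w_pos[of r] mult_right_mono[of "real (5 * h)" "2 * real (card ?I)" "weight r"] by simp
  also have "real (card ?I) * weight r = measure M R"
    using measure_descendants[OF fin, of r] 2(2) by simp
  finally show ?thesis .
qed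

lemma common_ancestor: "\<exists>i j. (par ^^ i) x = (par ^^ j) y"
proof -
  have "\<exists>i j. (par ^^ i) x = (par ^^ j) y" if "(adj ^^ n) x y" for n
    using that
  proof (induction n arbitrary: y)
    case 0
    then show ?case by auto
  next
    case (Suc n)
    then obtain z where z: "(adj ^^ n) x z" "adj z y" by auto
    with Suc.IH obtain i j where ij: "(par ^^ i) x = (par ^^ j) z" by blast
    from z(2) consider "y = par z" | "z = par y" by (auto simp: adj_iff)
    then show ?case
    proof cases
      case 1
      then have "(par ^^ Suc i) x = (par ^^ j) y" using ij by (simp add: funpow_swap1)
      then show ?thesis by blast
    next
      case 2
      then have "(par ^^ i) x = (par ^^ Suc j) y" using ij by (simp add: funpow_swap1)
      then show ?thesis by blast
    qed
  qed
  then show ?thesis using gdist_path by blast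
qed

text \<open>
  The root is taken so far above a common ancestor that the generations \<open>h + i\<close> and
  \<open>h + j\<close> of the two points both lie between \<open>h\<close> and \<open>2
  h\<close>.
\<close>

lemma cz_set_containing_pair: "\<exists>R h. cz_set adj lev R h \<and> x \<in> R \<and> y \<in> R"
proof -
  obtain i j where ij: "(par ^^ i) x = (par ^^ j) y" using common_ancestor by blast
  \<comment> \<open>\<open>h\<close> exceeds both \<open>i\<close> and \<open>j\<close>, and the 1 ensures \<open>1 \<le> h\<close>.\<close>
  define h where "h = i + j + 1"
  define r where "r = (par ^^ (h + i)) x"
  have y: "r = (par ^^ (h + j)) y" by (simp add: r_def funpow_add ij)
  let ?R = "\<Union>k\<in>{k. h \<le> 2 * k \<and> k < 4 * h}. descendants r k"
  have "x \<in> ?R" by (rule UN_I[of "h + i"]) (auto simp: h_def descendants_def r_def)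
  moreover have "y \<in> ?R" by (rule UN_I[of "h + j"]) (auto simp: h_def descendants_def y)
  moreover have "cz_set adj lev ?R h"
    unfolding cz_set_def cz_set_eq_descendants by (auto simp: h_def)
  ultimately show ?thesis by blast
qed

text \<open>
  Every vertex is a descendant of some iterated parent of \<open>x\<close>, so these finite sets
  exhaust the tree.
\<close>

definition exhaustion :: "'v \<Rightarrow> nat \<Rightarrow> 'v set" where
  "exhaustion x n = (\<Union>i<n. \<Union>j<n. descendants ((par ^^ i) x) j)"

lemma finite_exhaustion: "finite (exhaustion x n)"
  by (simp add: exhaustion_def finite_descendants)

lemma eventually_in_exhaustion: "\<forall>\<^sub>F n in sequentially. y \<in> exhaustion x n"
proof -
  obtain i j where ij: "(par ^^ i) x = (par ^^ j) y" using common_ancestor by blast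
  have "y \<in> exhaustion x n" if "n \<ge> i + j + 1" for n
    unfolding exhaustion_def using that ij
    by (intro UN_I[of i] UN_I[of j]) (auto simp: descendants_def)
  then show ?thesis unfolding eventually_sequentially by blast
qed

end

context levelled_tree
begin

sublocale rooted_at_infinity adj m lev parent
  by unfold_locales (use m_ge adj_iff_parent parent card_children in auto)

end


section \<open>Boundedness from \<open>L\<^sup>\<infinity>\<close> to \<open>BMO\<close>\<close>

theorem corollary16:
  fixes m :: nat and adj :: "'v \<Rightarrow> 'v \<Rightarrow> bool" and G :: "'v set" and N :: "'v \<Rightarrow> int"
    and T :: "('v \<Rightarrow> complex) \<Rightarrow> 'v \<Rightarrow> complex" and K :: "'v \<Rightarrow> 'v \<Rightarrow> complex"
    and lev :: "'v \<Rightarrow> int" and \<mu> :: "'v measure"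
  defines "lev \<equiv> level adj G N"
    and "\<mu> \<equiv> level_measure m lev"
  assumes "m \<ge> 2"
    and "homogeneous_tree m adj"
    and "infinite_geodesic adj G"
    and "\<forall>x\<in>G. \<forall>y\<in>G. \<bar>N x - N y\<bar> = int (gdist adj x y)"
    and "bounded_linear_on_L2 \<mu> T"
    and "locally_integrable_off_diagonal \<mu> K"
    and "admits_kernel \<mu> T K"
    and "(SUP (R, h)\<in>{(R, h). cz_set adj lev R h}. SUP y\<in>R. SUP z\<in>R.
           \<integral>\<^sup>+x\<in>- cz_dilation adj R h. ennreal (norm (K y x - K z x)) \<partial>\<mu>) < \<infinity>"
  shows "\<exists>S. bounded_linear_Linf_BMO adj lev \<mu> S \<and>
             (\<forall>f\<in>L2_space \<mu> \<inter> Linf_space \<mu>. eq_mod_const (S f) (T f))"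
proof -
  interpret tree: levelled_tree adj m G N
    by unfold_locales (use assms in \<open>auto simp: homogeneous_tree_def\<close>)
  have M: "tree.M = \<mu>"
    unfolding assms(1,2) by (rule tree.M_eq)
  define I where "I y z R' = (\<integral>\<^sup>+x\<in>- R'. ennreal (norm (K y x - K z x)) \<partial>\<mu>)" for y z R'
  define A where "A = (SUP (R, h)\<in>{(R, h). cz_set adj lev R h}. SUP y\<in>R. SUP z\<in>R. I y z (cz_dilation adj R h))"
  have A_fin: "A < \<infinity>" using assms(10) unfolding A_def I_def .
  have I_le: "I y z (cz_dilation adj R h) \<le> ennreal (enn2real A)"
    if "cz_set adj lev R h" "y \<in> R" "z \<in> R" for R h y z
  proof -
    have "I y z (cz_dilation adj R h) \<le> (SUP y\<in>R. SUP z\<in>R. I y z (cz_dilation adj R h))"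
      using that by (auto intro: SUP_upper2)
    also have "\<dots> \<le> A"
      unfolding A_def by (rule SUP_upper2[of "(R, h)"]) (use that in auto)
    finally show ?thesis using A_fin by (simp add: less_top)
  qed
  obtain C where C: "\<And>f. f \<in> L2_space \<mu> \<Longrightarrow> T f \<in> L2_space \<mu> \<and> L2_fnorm \<mu> (T f) \<le> C * L2_fnorm \<mu> f"
    using assms(7) unfolding bounded_linear_on_L2_def by blast
  have T_sq: "(LINT x|\<mu>. (norm (T f x))\<^sup>2) \<le> C\<^sup>2 * (LINT x|\<mu>. (norm (f x))\<^sup>2)"
    if "f \<in> L2_space \<mu>" for f
  proof -
    have "(L2_fnorm \<mu> (T f))\<^sup>2 \<le> (C * L2_fnorm \<mu> f)\<^sup>2"
      using C[OF that] by (intro power_mono) (auto simp: L2_fnorm_def)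
    then show ?thesis by (simp add: L2_fnorm_def power_mult_distrib)
  qed
  define F where "F = {(R, cz_dilation adj R h) | R h. cz_set adj lev R h}"
  interpret op: hormander_operator tree.weight T K F "tree.exhaustion undefined" "C\<^sup>2" "enn2real A" 2
  proof unfold_locales
    fix f g :: "'v \<Rightarrow> complex" and c :: complex
    assume f: "f \<in> L2_space tree.M"
    show "T (\<lambda>x. f x + g x) = (\<lambda>x. T f x + T g x)" if "g \<in> L2_space tree.M"
      using f that assms(7) unfolding M bounded_linear_on_L2_def by blast
    show "T (\<lambda>x. c * f x) = (\<lambda>x. c * T f x)"
      using f assms(7) unfolding M bounded_linear_on_L2_def by blast
    show "T f \<in> L2_space tree.M"
      using f C unfolding M by blast
    show "(LINT x|tree.M. (norm (T f x))\<^sup>2) \<le> C\<^sup>2 * (LINT x|tree.M. (norm (f x))\<^sup>2)"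
      using f T_sq unfolding M by blast
  next
    show "admits_kernel tree.M T K" using assms(9) unfolding M .
  next
    fix R R' :: "'v set" assume "(R, R') \<in> F"
    then obtain h where h: "cz_set adj lev R h" "R' = cz_dilation adj R h" by (auto simp: F_def)
    show "finite R'" using h tree.finite_cz_dilation assms(1) by simp
    show "R \<subseteq> R'" using h tree.subset_cz_dilation tree.cz_set_h_ge assms(1) by simp
    show "measure tree.M R' \<le> 2 * measure tree.M R"
      using h tree.measure_cz_dilation assms(1) by simp
    fix y z assume "y \<in> R" "z \<in> R"
    then show "(\<integral>\<^sup>+x\<in>- R'. ennreal (norm (K y x - K z x)) \<partial>tree.M) \<le> ennreal (enn2real A)"
      using I_le h unfolding I_def M by simp
  next
    fix x y :: 'v
    show "\<exists>R R'. (R, R') \<in> F \<and> x \<in> R \<and> y \<in> R"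
      using tree.cz_set_containing_pair[of x y] unfolding F_def assms(1) by blast
  qed (simp_all add: tree.finite_exhaustion tree.eventually_in_exhaustion)
  have bounded: "norm (f x) \<le> enn2real (Linf_norm \<mu> f)" if "f \<in> Linf_space \<mu>" for f :: "'v \<Rightarrow> complex" and x
    using tree.Linf_norm_ge[of f x] that enn2real_mono[of "ennreal (norm (f x))" "Linf_norm \<mu> f"]
    unfolding M by (simp add: Linf_space_def)
  let ?C = "1 + C\<^sup>2 * 2 + 2 * enn2real A"
  have bmo: "bmo_norm adj lev \<mu> (op.extension f) \<le> ennreal ?C * Linf_norm \<mu> f" if f: "f \<in> Linf_space \<mu>" for f
  proof -
    have "bmo_norm adj lev \<mu> (op.extension f) \<le> ennreal (?C * enn2real (Linf_norm \<mu> f))"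
      unfolding bmo_norm_def
    proof (rule SUP_least)
      fix R assume "R \<in> {R. \<exists>h. cz_set adj lev R h}"
      then obtain h where "(R, cz_dilation adj R h) \<in> F" by (auto simp: F_def)
      from op.extension_oscillation[OF this bounded[OF f]]
      show "(\<integral>\<^sup>+x\<in>R. ennreal (norm (op.extension f x - mean_on \<mu> R (op.extension f))) \<partial>\<mu>) / emeasure \<mu> R
        \<le> ennreal (?C * enn2real (Linf_norm \<mu> f))"
        unfolding M .
    qed
    also have "\<dots> = ennreal ?C * Linf_norm \<mu> f"
      using f by (simp add: ennreal_mult Linf_space_def less_top)
    finally show ?thesis .
  qed
  have bmo_fin: "bmo_norm adj lev \<mu> (op.extension f) < \<infinity>" if "f \<in> Linf_space \<mu>" for f
    using le_less_trans[OF bmo[OF that]] that by (simp add: Linf_space_def ennreal_mult_less_top)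
  have "bounded_linear_Linf_BMO adj lev \<mu> op.extension"
    unfolding bounded_linear_Linf_BMO_def
  proof (intro conjI ballI allI exI[of _ ?C] bmo_fin bmo)
    fix f g assume fg: "f \<in> Linf_space \<mu>" "g \<in> Linf_space \<mu>"
    show "eq_mod_const (op.extension (\<lambda>x. f x + g x)) (\<lambda>x. op.extension f x + op.extension g x)"
      unfolding eq_mod_const_def
      using op.extension_add[OF bounded[OF fg(1)] bounded[OF fg(2)]] by (intro exI[of _ 0]) simp
  next
    fix c f
    show "eq_mod_const (op.extension (\<lambda>x. c * f x)) (\<lambda>x. c * op.extension f x)"
      unfolding eq_mod_const_def using op.extension_scale by (intro exI[of _ 0]) simp
  qed
  moreover have "eq_mod_const (op.extension f) (T f)" if "f \<in> L2_space \<mu> \<inter> Linf_space \<mu>" for f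
    unfolding eq_mod_const_def
    using op.extension_extends[of f, unfolded M] bounded that
    by (intro exI[of _ "- T f op.basepoint"]) auto
  ultimately show ?thesis by blast
qed

end
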